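(* Let $\mathbf{A}=\mathbf{T}(A,\Omega)+\mathbf{A}_0\in\mathcal{T}_n\otimes\mathcal{A}$, where $A=(0,A_1,\dots,A_{n-1})^{t}$ and $\Omega=(0,\Omega_1,\dots,\Omega_{n-1})^{t}$ are block columns with entries in $\mathcal{A}$ and $\mathbf{A}_0\in\mathcal{D}_n\otimes\mathcal{A}$. Then $\mathbf{A}$ is normal (i.e. $\mathbf{A}\mathbf{A}^*=\mathbf{A}^*\mathbf{A}$) if and only if for every $s$ and $k$ with $1\le s,k\le n-1$, $$A_sA_k^*+A_{n-s}^*A_{n-k}=\Omega_s\Omega_k^*+\Omega_{n-s}^*\Omega_{n-k}.$$
   Context: Let $n,d$ be positive integers, $\mathcal{M}_d$ the algebra of complex $d\times d$ matrices, $X^*$ the conjugate transpose of $X$. $\mathcal{A}\subseteq\mathcal{M}_d$ is a fixed commutative subalgebra containing the identity matrix $I$. $\mathcal{T}_n\otimes\mathcal{A}$ is the set of $n\times n$ block Toeplitz matrices (blocks constant along diagonals) whose blocks all belong to $\mathcal{A}$; $\mathcal{D}_n\otimes\mathcal{A}$ is the set of $n\times n$ diagonal block Toeplitz matrices with blocks in $\mathcal{A}$, i.e. block diagonal matrices with the same block of $\mathcal{A}$ repeated along the diagonal. For block columns $A=(0,A_1,\dots,A_{n-1})^{t}$, $\Omega=(0,\Omega_1,\dots,\Omega_{n-1})^{t}$ with entries in $\mathcal{A}$ (here $t$ only indicates that the blocks are stacked in a column), $\mathbf{T}(A,\Omega)$ is the $n\times n$ block Toeplitz matrix whose $(i,j)$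 block ($1\le i,j\le n$) is $A_{i-j}$ if $i>j$, $\Omega_{j-i}^*$ if $i<j$, and $0$ if $i=j$.
   Formalization: The commutative algebra 𝒜 is additionally assumed closed under conjugate transpose; without this the claim fails, e.g. for A = Ω = 0 and A_0 block diagonal with a repeated non-normal block N, 𝒜 = span{I, N}. *)

theory Defs
  imports "Jordan_Normal_Form.Schur_Decomposition"
begin

definition commutative_unital_subalgebra :: "nat \<Rightarrow> complex mat set \<Rightarrow> bool" where
  "commutative_unital_subalgebra d \<A> \<longleftrightarrow>
     \<A> \<subseteq> carrier_mat d d \<and> 1\<^sub>m d \<in> \<A> \<and>
     (\<forall>X\<in>\<A>. \<forall>Y\<in>\<A>. X + Y \<in> \<A> \<and> X * Y \<in> \<A> \<and> X * Y = Y * X) \<and>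
     (\<forall>c. \<forall>X\<in>\<A>. c \<cdot>\<^sub>m X \<in> \<A>)"

text \<open>Block indices and matrix indices are both 0-based: the block in position \<open>(i, j)\<close>,
  \<open>i, j < n\<close>, occupies the rows \<open>i * d, \<dots>, i * d + d - 1\<close> and the columns
  \<open>j * d, \<dots>, j * d + d - 1\<close> of an ordinary complex matrix of size \<open>n * d\<close>.\<close>

definition block_mat :: "nat \<Rightarrow> nat \<Rightarrow> (nat \<Rightarrow> nat \<Rightarrow> complex mat) \<Rightarrow> complex mat" where
  "block_mat n d B = mat (n * d) (n * d)
     (\<lambda>(r, c). B (r div d) (c div d) $$ (r mod d, c mod d))"

definition block_toeplitz :: "nat \<Rightarrow> nat \<Rightarrow> complex mat set \<Rightarrow> complex mat set" where
  "block_toeplitz n d \<A> = {block_mat n d B | B.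
     (\<forall>i<n. \<forall>j<n. B i j \<in> \<A>) \<and>
     (\<forall>i j. Suc i < n \<longrightarrow> Suc j < n \<longrightarrow> B (Suc i) (Suc j) = B i j)}"

definition block_diag_toeplitz :: "nat \<Rightarrow> nat \<Rightarrow> complex mat set \<Rightarrow> complex mat set" where
  "block_diag_toeplitz n d \<A> =
     {block_mat n d (\<lambda>i j. if i = j then X else 0\<^sub>m d d) | X. X \<in> \<A>}"

text \<open>Block columns \<open>(0, A\<^sub>1, \<dots>, A\<^sub>n\<^sub>-\<^sub>1)\<close>; values at indices \<open>\<ge> n\<close> are irrelevant.\<close>

definition block_columns :: "nat \<Rightarrow> nat \<Rightarrow> complex mat set \<Rightarrow> (nat \<Rightarrow> complex mat) set" where
  "block_columns n d \<A> = {A. A 0 = 0\<^sub>m d d \<and> (\<forall>k\<in>{1..<n}. A k \<in> \<A>)}"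

definition toeplitz_of ::
    "nat \<Rightarrow> nat \<Rightarrow> (nat \<Rightarrow> complex mat) \<Rightarrow> (nat \<Rightarrow> complex mat) \<Rightarrow> complex mat" where
  "toeplitz_of n d A \<Omega> = block_mat n d
     (\<lambda>i j. if i > j then A (i - j)
            else if i < j then mat_adjoint (\<Omega> (j - i))
            else 0\<^sub>m d d)"

end

theory Submission
  imports Defs
begin

text \<open>Commutativity turns the commutator \<open>C = M M\<^sup>* - M\<^sup>* M\<close> of a block Toeplitz matrix into a
  matrix with \<open>C\<^bsub>n-1-i,n-1-j\<^esub> = - C\<^bsub>j,i\<^esub>\<close>. The stated identities say exactly that
  \<open>C\<^bsub>s,k\<^esub> = C\<^bsub>s-1,k-1\<^esub>\<close>, i.e. that \<open>C\<close> is itself block Toeplitz; then also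
  \<open>C\<^bsub>n-1-i,n-1-j\<^esub> = C\<^bsub>j,i\<^esub>\<close>, so \<open>C = 0\<close>.\<close>

text \<open>The shift hypothesis moves an entry one place down its diagonal, and iterating it links
  any two places on that diagonal. \<open>i + j' = i' + j\<close> expresses that
  \<open>i - j\<close> and \<open>i' - j'\<close> agree as integers, avoiding truncated
  subtraction.\<close>

lemma toeplitz_eqI:
  fixes C :: "nat \<Rightarrow> nat \<Rightarrow> 'a"
  assumes shift: "\<And>i j. Suc i < n \<Longrightarrow> Suc j < n \<Longrightarrow> C (Suc i) (Suc j) = C i j"
    and "i < n" "j < n" "i' < n" "j' < n" "i + j' = i' + j"
  shows "C i j = C i' j'"
proof -
  have add: "C (i + t) (j + t) = C i j" if "i + t < n" "j + t < n" for i j t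
    using that by (induction t) (auto simp: shift)
  show ?thesis
  proof (cases "i \<le> i'")
    case True
    moreover from True assms have "j + (i' - i) = j'" by simp
    ultimately show ?thesis using add[of i "i' - i" j] assms by simp
  next
    case False
    moreover from False assms have "j' + (i - i') = j" by simp
    ultimately show ?thesis using add[of i' "i - i'" j'] assms by simp
  qed
qed

text \<open>Here \<open>F p q\<close> stands for an entry of \<open>T\<^sub>p T\<^sub>q\<^sup>* = T\<^sub>q\<^sup>* T\<^sub>p\<close>, where \<open>T\<^sub>p\<close> is the
  block on the \<open>p\<close>-th diagonal.\<close>

lemma toeplitz_commutator_zero_iff:
  fixes F :: "int \<Rightarrow> int \<Rightarrow> 'a :: field_char_0"
  shows "(\<forall>i<n. \<forall>j<n. (\<Sum>l<n. F (int i - int l) (int j - int l)) =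
            (\<Sum>l<n. F (int l - int j) (int l - int i))) \<longleftrightarrow>
         (\<forall>s\<in>{1..n-1}. \<forall>k\<in>{1..n-1}.
            F s k + F (int n - k) (int n - s) = F (- int k) (- int s) + F (s - int n) (k - int n))"
    (is "?zero \<longleftrightarrow> ?cond")
proof -
  \<comment> \<open>For one fixed place inside the blocks, the first sum is the entry of
    \<open>M * mat_adjoint M\<close> in block \<open>(i, j)\<close>. The second is that of
    \<open>mat_adjoint M * M\<close>, with the factors already commuted into the order of
    \<open>F\<close>.\<close>
  define C where "C i j = (\<Sum>l<n. F (int i - int l) (int j - int l)) -
    (\<Sum>l<n. F (int l - int j) (int l - int i))" for i j
  have zero: "?zero \<longleftrightarrow> (\<forall>i<n. \<forall>j<n. C i j = 0)"
    by (simp add: C_def)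
  \<comment> \<open>Raising \<open>i\<close>, \<open>j\<close> and \<open>l\<close> together leaves
    all arguments of \<open>F\<close> unchanged, so the sums telescope. What survives is the term
    \<open>l = 0\<close> of the shifted sums and the term \<open>l = n - 1\<close> of the unshifted
    ones.\<close>
  have step: "C (Suc i) (Suc j) - C i j =
      F (Suc i) (Suc j) + F (int n - Suc j) (int n - Suc i)
      - (F (- int (Suc j)) (- int (Suc i)) + F (Suc i - int n) (Suc j - int n))"
    if n: "0 < n" for i j
  proof -
    obtain m where m: "n = Suc m" using n by (cases n) auto
    have "(\<Sum>l<n. F (int (Suc i) - int l) (int (Suc j) - int l)) =
        F (Suc i) (Suc j) + (\<Sum>l<m. F (int i - int l) (int j - int l))"
      unfolding m by (subst sum.lessThan_Suc_shift) simp
    moreover have "(\<Sum>l<n. F (int l - int (Suc j)) (int l - int (Suc i))) =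
        F (- int (Suc j)) (- int (Suc i)) + (\<Sum>l<m. F (int l - int j) (int l - int i))"
      unfolding m by (subst sum.lessThan_Suc_shift) simp
    ultimately show ?thesis
      unfolding C_def by (simp add: m algebra_simps)
  qed
  have cond: "?cond \<longleftrightarrow> (\<forall>i j. Suc i < n \<longrightarrow> Suc j < n \<longrightarrow> C (Suc i) (Suc j) = C i j)" (is "_ \<longleftrightarrow> ?shift")
  proof
    assume c: ?cond
    show ?shift
    proof (intro allI impI)
      fix i j assume "Suc i < n" "Suc j < n"
      with c[rule_format, of "Suc i" "Suc j"] step[of i j]
      show "C (Suc i) (Suc j) = C i j" by auto
    qed
  next
    assume c: ?shift
    show ?cond
    proof (intro ballI)
      fix s k assume "s \<in> {1..n-1}" "k \<in> {1..n-1}"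
      then obtain i j where "s = Suc i" "k = Suc j" "Suc i < n" "Suc j < n"
        by (cases s; cases k) auto
      then show "F s k + F (int n - k) (int n - s) =
          F (- int k) (- int s) + F (s - int n) (k - int n)"
        using c step[of i j] by auto
    qed
  qed
  \<comment> \<open>Reversing the summation by replacing \<open>l\<close> with
    \<open>n - 1 - l\<close> turns each of the two sums into the other sum of \<open>C j i\<close>;
    hence the sign and the swapped indices.\<close>
  have flip: "C (n - Suc i) (n - Suc j) = - C j i" if "i < n" "j < n" for i j
  proof -
    have "(\<Sum>l<n. F (int (n - Suc i) - int l) (int (n - Suc j) - int l)) =
        (\<Sum>l<n. F (int l - int i) (int l - int j))"
      by (subst sum.nat_diff_reindex[symmetric])
        (use that in \<open>auto intro!: sum.cong arg_cong2[of _ _ _ _ F]\<close>)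
    moreover have "(\<Sum>l<n. F (int l - int (n - Suc j)) (int l - int (n - Suc i))) =
        (\<Sum>l<n. F (int j - int l) (int i - int l))"
      by (subst sum.nat_diff_reindex[symmetric])
        (use that in \<open>auto intro!: sum.cong arg_cong2[of _ _ _ _ F]\<close>)
    ultimately show ?thesis by (simp add: C_def)
  qed
  have "C i j = 0" if shift: ?shift and ij: "i < n" "j < n" for i j
  proof -
    \<comment> \<open>Reflection in the antidiagonal keeps every place on its diagonal, so a
      Toeplitz \<open>C\<close> is invariant under it, whereas \<open>flip\<close> makes it change
      sign. Characteristic 0 then forces \<open>C i j = 0\<close>.\<close>
    have "C (n - Suc j) (n - Suc i) = C i j"
      by (rule toeplitz_eqI[of n C]) (use shift ij in auto)
    with flip[of j i] ij have "C i j = - C i j" by simp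
    then show ?thesis by simp
  qed
  then have "?shift \<Longrightarrow> \<forall>i<n. \<forall>j<n. C i j = 0" by blast
  moreover have "\<forall>i<n. \<forall>j<n. C i j = 0 \<Longrightarrow> ?shift" by simp
  ultimately show ?thesis unfolding zero cond by (rule iffI[rotated])
qed

section \<open>Entries, adjoints and products of block matrices\<close>

lemma block_index_less:
  fixes i n a d :: nat
  assumes "i < n" "a < d"
  shows "i * d + a < n * d"
proof -
  have "i * d + a < Suc i * d" using assms by simp
  also have "\<dots> \<le> n * d" using assms by (intro mult_le_mono1) simp
  finally show ?thesis .
qed

lemma block_mat_carrier [simp]: "block_mat n d B \<in> carrier_mat (n * d) (n * d)"
  by (simp add: block_mat_def)

lemma block_mat_dim [simp]:
  "dim_row (block_mat n d B) = n * d" "dim_col (block_mat n d B) = n * d"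
  by (simp_all add: block_mat_def)

lemma block_mat_index [simp]:
  assumes "i < n" "j < n" "a < d" "b < d"
  shows "block_mat n d B $$ (i * d + a, j * d + b) = B i j $$ (a, b)"
  using assms by (simp add: block_mat_def block_index_less)

lemma block_eq_iff:
  assumes "M \<in> carrier_mat (n * d) (n * d)" "N \<in> carrier_mat (n * d) (n * d)"
  shows "M = N \<longleftrightarrow> (\<forall>i<n. \<forall>j<n. \<forall>a<d. \<forall>b<d.
    M $$ (i * d + a, j * d + b) = N $$ (i * d + a, j * d + b))" (is "_ \<longleftrightarrow> ?R")
proof
  assume R: ?R
  show "M = N"
  proof (rule eq_matI)
    fix r c assume "r < dim_row N" "c < dim_col N"
    then have rc: "r < n * d" "c < n * d" using assms by auto
    \<comment> \<open>The row index \<open>r < n * d\<close> can exist only for positive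
      \<open>d\<close>; this makes remainders modulo \<open>d\<close> valid indices inside a
      block.\<close>
    then have "0 < d" by (cases d) auto
    then have "r div d < n" "c div d < n" "r mod d < d" "c mod d < d"
      using rc by (simp_all add: less_mult_imp_div_less)
    with R have "M $$ (r div d * d + r mod d, c div d * d + c mod d) =
      N $$ (r div d * d + r mod d, c div d * d + c mod d)" by blast
    then show "M $$ (r, c) = N $$ (r, c)" by simp
  qed (use assms in auto)
qed simp

lemma mat_eq_iff:
  assumes "M \<in> carrier_mat m n" "N \<in> carrier_mat m n"
  shows "M = N \<longleftrightarrow> (\<forall>a<m. \<forall>b<n. M $$ (a, b) = N $$ (a, b))"
  using assms by auto

lemma mat_adjoint_dim [simp]:
  "dim_row (mat_adjoint X) = dim_col X" "dim_col (mat_adjoint X) = dim_row X"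
  by (simp_all add: mat_adjoint_def)

lemma mat_adjoint_carrier [simp]:
  "X \<in> carrier_mat m n \<Longrightarrow> mat_adjoint X \<in> carrier_mat n m"
  by auto

lemma mat_adjoint_index:
  assumes "X \<in> carrier_mat m n" "a < n" "b < m"
  shows "mat_adjoint X $$ (a, b) = conjugate (X $$ (b, a))"
  using assms by (auto simp: mat_adjoint_def mat_of_rows_index)

lemma mat_adjoint_adjoint:
  assumes "X \<in> carrier_mat m n"
  shows "mat_adjoint (mat_adjoint X) = X"
  using assms
  by (subst mat_eq_iff[of _ m n])
    (auto simp: mat_adjoint_index[of X m n] mat_adjoint_index[of "mat_adjoint X" n m])

lemma mat_adjoint_block_mat:
  assumes "\<And>i j. i < n \<Longrightarrow> j < n \<Longrightarrow> B i j \<in> carrier_mat d d"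
  shows "mat_adjoint (block_mat n d B) = block_mat n d (\<lambda>i j. mat_adjoint (B j i))"
  using assms
  by (subst block_eq_iff)
    (auto simp: mat_adjoint_index[of _ "n * d" "n * d"] mat_adjoint_index[of _ d d] block_index_less)

text \<open>The summation range of length \<open>n * d\<close> splits into \<open>n\<close> segments
  of length \<open>d\<close>, and segment \<open>l\<close> contributes one entry of
  \<open>B i l * B' l j\<close>. The result stays a sum of complex numbers, the form to which
  \<open>toeplitz_commutator_zero_iff\<close> applies.\<close>

lemma block_mat_mult_index:
  assumes B: "\<And>i j. i < n \<Longrightarrow> j < n \<Longrightarrow> B i j \<in> carrier_mat d d"
    and B': "\<And>i j. i < n \<Longrightarrow> j < n \<Longrightarrow> B' i j \<in> carrier_mat d d"
    and ij: "i < n" "j < n" and ab: "a < d" "b < d"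
  shows "(block_mat n d B * block_mat n d B') $$ (i * d + a, j * d + b) =
    (\<Sum>l<n. (B i l * B' l j) $$ (a, b))"
proof -
  define g where "g m = block_mat n d B $$ (i * d + a, m) * block_mat n d B' $$ (m, j * d + b)" for m
  have "(block_mat n d B * block_mat n d B') $$ (i * d + a, j * d + b) = sum g {0..<n * d}"
    using ij ab by (simp add: scalar_prod_def block_index_less g_def)
  also have "\<dots> = (\<Sum>l<n. sum g {l * d..<l * d + d})"
    by (simp add: sum.nat_group atLeast0LessThan)
  also have "\<dots> = (\<Sum>l<n. (B i l * B' l j) $$ (a, b))"
  proof (rule sum.cong[OF refl])
    fix l assume "l \<in> {..<n}"
    then have l: "l < n" by simp
    have "sum g {l * d..<l * d + d} = (\<Sum>c\<in>{0..<d}. g (l * d + c))"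
      using sum.shift_bounds_nat_ivl[of g 0 "l * d" d] by (simp add: add.commute)
    also have "\<dots> = (B i l * B' l j) $$ (a, b)"
      using B[OF ij(1) l] B'[OF l ij(2)] l ij ab by (auto simp: scalar_prod_def g_def)
    finally show "sum g {l * d..<l * d + d} = (B i l * B' l j) $$ (a, b)" .
  qed
  finally show ?thesis .
qed

section \<open>Reduction of normality to scalar commutators\<close>

theorem theorem5p2:
  fixes n d :: nat
    and \<A> :: "complex mat set"
    and A \<Omega> :: "nat \<Rightarrow> complex mat"
    and A\<^sub>0 M :: "complex mat"
  assumes "n \<ge> 1" and "d \<ge> 1"
    and "commutative_unital_subalgebra d \<A>"
    and "\<forall>X\<in>\<A>. mat_adjoint X \<in> \<A>"
    and "A \<in> block_columns n d \<A>"
    and "\<Omega> \<in> block_columns n d \<A>"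
    and "A\<^sub>0 \<in> block_diag_toeplitz n d \<A>"
    and "M = toeplitz_of n d A \<Omega> + A\<^sub>0"
    and "M \<in> block_toeplitz n d \<A>"
  shows "M * mat_adjoint M = mat_adjoint M * M \<longleftrightarrow>
    (\<forall>s\<in>{1..n-1}. \<forall>k\<in>{1..n-1}.
       A s * mat_adjoint (A k) + mat_adjoint (A (n - s)) * A (n - k) =
       \<Omega> s * mat_adjoint (\<Omega> k) + mat_adjoint (\<Omega> (n - s)) * \<Omega> (n - k))"
proof -
  obtain X where X: "X \<in> \<A>"
    and A\<^sub>0: "A\<^sub>0 = block_mat n d (\<lambda>i j. if i = j then X else 0\<^sub>m d d)"
    using assms(7) by (auto simp: block_diag_toeplitz_def)
  have carr: "Y \<in> carrier_mat d d" if "Y \<in> \<A>" for Y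
    using assms(3) that by (auto simp: commutative_unital_subalgebra_def)
  have comm: "Y * Z = Z * Y" if "Y \<in> \<A>" "Z \<in> \<A>" for Y Z
    using assms(3) that by (auto simp: commutative_unital_subalgebra_def)
  \<comment> \<open>Together with \<open>comm\<close> this lets the adjoint of any block commute
    with every block, so each block is itself normal.\<close>
  have adj: "mat_adjoint Y \<in> \<A>" if "Y \<in> \<A>" for Y
    using assms(4) that by blast
  have A: "A k \<in> \<A>" and \<Omega>: "\<Omega> k \<in> \<A>" if "k \<in> {1..<n}" for k
    using assms(5,6) that by (auto simp: block_columns_def)
  \<comment> \<open>A single sequence indexed by the integers \<open>i - j\<close> covers the lower
    blocks, the adjoints above the diagonal and the diagonal block \<open>X\<close>, so the product
    sums need no case distinctions.\<close>
  define T where "T p = (if p > 0 then A (nat p) else if p < 0 then mat_adjoint (\<Omega> (nat (- p)))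
    else X)" for p :: int
  have T: "T p \<in> \<A>" if "\<bar>p\<bar> < int n" for p
    using that by (auto simp: T_def X intro!: A adj \<Omega>)
  have M: "M = block_mat n d (\<lambda>i j. T (int i - int j))"
    unfolding assms(8) toeplitz_of_def A\<^sub>0
  proof (subst block_eq_iff, safe)
    fix i j a b assume h: "i < n" "j < n" "a < d" "b < d"
    have "j < i \<Longrightarrow> A (i - j) \<in> carrier_mat d d" "i < j \<Longrightarrow> mat_adjoint (\<Omega> (j - i)) \<in> carrier_mat d d"
      using h by (auto intro!: carr A adj \<Omega>)
    then show "(block_mat n d (\<lambda>i j. if j < i then A (i - j) else if i < j
        then mat_adjoint (\<Omega> (j - i)) else 0\<^sub>m d d) +
      block_mat n d (\<lambda>i j. if i = j then X else 0\<^sub>m d d)) $$ (i * d + a, j * d + b) =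
      block_mat n d (\<lambda>i j. T (int i - int j)) $$ (i * d + a, j * d + b)"
      using h carr[OF X] by (auto simp: block_index_less T_def nat_diff_distrib)
  qed auto
  define F where "F a b p q = (T p * mat_adjoint (T q)) $$ (a, b)" for a b p q
  have cT: "T (int i - int j) \<in> carrier_mat d d" if "i < n" "j < n" for i j
    using that by (intro carr T) auto
  have Mc: "M \<in> carrier_mat (n * d) (n * d)"
    unfolding M by simp
  have M': "mat_adjoint M = block_mat n d (\<lambda>i j. mat_adjoint (T (int j - int i)))"
    unfolding M by (rule mat_adjoint_block_mat) (rule cT)
  have MM': "(M * mat_adjoint M) $$ (i * d + a, j * d + b) =
      (\<Sum>l<n. F a b (int i - int l) (int j - int l))"
    if "i < n" "j < n" "a < d" "b < d" for i j a b
    unfolding M' unfolding M F_def using that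
    by (intro block_mat_mult_index) (simp_all add: cT)
  have M'M: "(mat_adjoint M * M) $$ (i * d + a, j * d + b) =
      (\<Sum>l<n. F a b (int l - int j) (int l - int i))"
    if h: "i < n" "j < n" "a < d" "b < d" for i j a b
  proof -
    have "(mat_adjoint M * M) $$ (i * d + a, j * d + b) =
        (\<Sum>l<n. (mat_adjoint (T (int l - int i)) * T (int l - int j)) $$ (a, b))"
      unfolding M' unfolding M using h
      by (intro block_mat_mult_index) (simp_all add: cT)
    \<comment> \<open>Here commutativity enters: the adjoint factor moves to the right, so both
      products are expressed through the same \<open>F\<close>.\<close>
    also have "\<dots> = (\<Sum>l<n. F a b (int l - int j) (int l - int i))"
      unfolding F_def using h
      by (intro sum.cong refl arg_cong[of _ _ "\<lambda>Y. Y $$ (a, b)"] comm adj T) auto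
    finally show ?thesis .
  qed
  \<comment> \<open>The place \<open>(a, b)\<close> inside the blocks is quantified outermost, so
    that the scalar criterion can be applied to each \<open>F a b\<close> separately.\<close>
  have "M * mat_adjoint M = mat_adjoint M * M \<longleftrightarrow>
      (\<forall>a<d. \<forall>b<d. \<forall>i<n. \<forall>j<n. (\<Sum>l<n. F a b (int i - int l) (int j - int l)) =
            (\<Sum>l<n. F a b (int l - int j) (int l - int i)))"
    using mult_carrier_mat[OF Mc mat_adjoint_carrier[OF Mc]]
      mult_carrier_mat[OF mat_adjoint_carrier[OF Mc] Mc]
    by (subst block_eq_iff[of _ n d]) (auto simp: MM' M'M simp del: index_mult_mat(1))
  also have "\<dots> \<longleftrightarrow> (\<forall>a<d. \<forall>b<d. \<forall>s\<in>{1..n-1}. \<forall>k\<in>{1..n-1}.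
            F a b s k + F a b (int n - k) (int n - s) =
            F a b (- int k) (- int s) + F a b (s - int n) (k - int n))"
    by (simp only: toeplitz_commutator_zero_iff)
  also have "\<dots> \<longleftrightarrow> (\<forall>s\<in>{1..n-1}. \<forall>k\<in>{1..n-1}. \<forall>a<d. \<forall>b<d.
            F a b s k + F a b (int n - k) (int n - s) =
            F a b (- int k) (- int s) + F a b (s - int n) (k - int n))"
    by blast
  also have "\<dots> \<longleftrightarrow> (\<forall>s\<in>{1..n-1}. \<forall>k\<in>{1..n-1}.
       A s * mat_adjoint (A k) + mat_adjoint (A (n - s)) * A (n - k) =
       \<Omega> s * mat_adjoint (\<Omega> k) + mat_adjoint (\<Omega> (n - s)) * \<Omega> (n - k))"
  proof (intro ball_cong refl)
    fix s k assume sk: "s \<in> {1..n-1}" "k \<in> {1..n-1}"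
    have pos: "T (int m) = A m" "T (- int m) = mat_adjoint (\<Omega> m)"
      "A m \<in> \<A>" "\<Omega> m \<in> \<A>"
      "A m \<in> carrier_mat d d" "\<Omega> m \<in> carrier_mat d d"
      if "m \<in> {1..<n}" for m
      using that carr[OF \<Omega>[OF that]] carr[OF A[OF that]] A[OF that] \<Omega>[OF that]
      by (auto simp: T_def mat_adjoint_adjoint)
    \<comment> \<open>All four indices lie strictly between 0 and \<open>n\<close>, so
      \<open>T\<close> is never evaluated at 0. This is why \<open>X\<close> is absent from the
      criterion.\<close>
    have mem: "s \<in> {1..<n}" "k \<in> {1..<n}" "n - s \<in> {1..<n}" "n - k \<in> {1..<n}"
      using sk by auto
    have diff: "int n - int s = int (n - s)" "int n - int k = int (n - k)"
      "int s - int n = - int (n - s)" "int k - int n = - int (n - k)"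
      using sk by auto
    note p = mem[THEN pos(1)] mem[THEN pos(2)]
    note in_\<A> = mem[THEN pos(3)] mem[THEN pos(4)]
    note c = mem[THEN pos(5)] mem[THEN pos(6)]
    \<comment> \<open>In \<open>F\<close> the second factor is the adjoint of a block
      \<open>T q\<close>, so the second product on the left and the first on the right must be
      commuted. For negative \<open>q\<close> that block is itself an adjoint, and the double
      adjoint leaves a plain \<Omega> factor.\<close>
    have "(A s * mat_adjoint (A k) + mat_adjoint (A (n - s)) * A (n - k) =
       \<Omega> s * mat_adjoint (\<Omega> k) + mat_adjoint (\<Omega> (n - s)) * \<Omega> (n - k)) \<longleftrightarrow>
      (A s * mat_adjoint (A k) + A (n - k) * mat_adjoint (A (n - s)) =
       mat_adjoint (\<Omega> k) * \<Omega> s + mat_adjoint (\<Omega> (n - s)) * \<Omega> (n - k))"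
      using in_\<A> by (simp add: comm adj)
    also have "\<dots> \<longleftrightarrow> (\<forall>a<d. \<forall>b<d.
            F a b s k + F a b (int n - k) (int n - s) =
            F a b (- int k) (- int s) + F a b (s - int n) (k - int n))"
      unfolding F_def diff p
      by (subst mat_eq_iff[of _ d d])
        (use c in \<open>auto simp: mat_adjoint_adjoint[of _ d d] simp del: index_mult_mat(1)\<close>)
    finally show "(\<forall>a<d. \<forall>b<d.
            F a b s k + F a b (int n - k) (int n - s) =
            F a b (- int k) (- int s) + F a b (s - int n) (k - int n)) \<longleftrightarrow>
       (A s * mat_adjoint (A k) + mat_adjoint (A (n - s)) * A (n - k) =
       \<Omega> s * mat_adjoint (\<Omega> k) + mat_adjoint (\<Omega> (n - s)) * \<Omega> (n - k))" ..
  qed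
  finally show ?thesis .
qed

end
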